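(* Let $q$ be a prime power, $k\ge 2$, $N\ge k$ and $n$ be positive integers, and let $(n,d_1,\ldots,d_{k-1})$ be such that a generalised arc of order $k-2$ with $N+1$ elements and parameters $(n,d_1,\ldots,d_{k-1})$ exists in $PG(n,q)$. In $PG(n+1,q)$, select a $(d_1+1)$-dimensional subspace $\pi'$ and make it public. In $\pi'$, select a $d_1$-dimensional subspace $\pi$ as the secret. Choose any hyperplane $\Pi$ of $PG(n+1,q)$ that contains $\pi$ but not $\pi'$. Let $\mathcal{A}$ be a generalised arc of $\Pi$ of order $k-2$ with $N+1$ elements and parameters $(n,d_1,\ldots,d_{k-1})$ such that $\pi$ is an element of $\mathcal{A}$. The $N$ elements of $\mathcal{A}$ different from $\pi$ are the shares. This describes a $k$-out-of-$N$ secret sharing scheme with the attack probabilities $$p_i=\frac{q-1}{q^{d_{i+1}-d_i+1}-1}\qquad (0\le i<k),$$ where formally $d_0=-1$ and $d_k=n$.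
   Context: All dimensions are projective (the empty subspace has dimension $-1$). A generalised arc of order $d$ with parameters $(n,n_1,\ldots,n_{d+1})$, $-1<n_1<n_2<\cdots<n_{d+1}<n$, in $PG(n,q)$ is a set of $n_1$-dimensional subspaces of $PG(n,q)$ such that each $j$ of them generate a subspace of dimension $n_j$ ($1\le j\le d+1$), and each $d+2$ of them span $PG(n,q)$. A $k$-out-of-$N$ secret sharing scheme: a dealer generates $N$ shares and a secret, and the shares are given to $N$ different participants; each $k$ participants can reconstruct the secret from their shares and the public data, and fewer than $k$ participants cannot. The attack probability $p_i$ ($i<k$) is the (maximal) probability with which $i$ participants, knowing only their $i$ shares and all public data, can guess the secret correctly. Here the public data are $q,n,k,N$, the parameters $(n,d_1,\ldots,d_{k-1})$ and the subspace $\pi'$, and the selection is made as follows: given $\pi'$, the triple consisting of $\pi$, $\Pi$ and the $N$-tuple $(\pi_1,\ldots,\pi_N)$ of elements of $\mathcal{A}\setminus\{\pi\}$ is chosen uniformly at random among all admissible choices. *)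

theory Defs
  imports "HOL-Analysis.Analysis" "HOL-Probability.Probability"
begin

text \<open>
  \<open>PG(m,q)\<close> is the lattice of linear subspaces of a coordinate space of vector dimension \<open>m + 1\<close>
  over a finite field with \<open>q\<close> elements: subspaces of \<open>'a ^ 'n\<close> with \<open>CARD('a) = q\<close> and
  \<open>CARD('n) = m + 1\<close>. The zero subspace plays the role of the empty projective subspace.
\<close>

definition proj_dim :: "('a::field ^ 'n) set \<Rightarrow> int" where
  "proj_dim W = int (vec.dim W) - 1"

definition generated :: "('a::field ^ 'n) set set \<Rightarrow> ('a ^ 'n) set" where
  "generated S = vec.span (\<Union>S)"

text \<open>
  The ambient projective space is a subspace \<open>W\<close> of projective dimension \<open>n\<close>, so that the notion
  applies both to a full space (\<open>W = UNIV\<close>) and to a hyperplane of a larger space.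
  Only the values \<open>ns 1, \<dots>, ns (d + 1)\<close> are parameters of the arc.
\<close>

definition generalised_arc ::
  "nat \<Rightarrow> nat \<Rightarrow> (nat \<Rightarrow> int) \<Rightarrow> ('a::field ^ 'n) set \<Rightarrow> ('a ^ 'n) set set \<Rightarrow> bool" where
  "generalised_arc d n ns W A \<longleftrightarrow>
     vec.subspace W \<and> proj_dim W = int n \<and>
     -1 < ns 1 \<and> (\<forall>j\<in>{1..d}. ns j < ns (j + 1)) \<and> ns (d + 1) < int n \<and>
     (\<forall>X\<in>A. vec.subspace X \<and> X \<subseteq> W \<and> proj_dim X = ns 1) \<and>
     (\<forall>j\<in>{1..d + 1}. \<forall>S\<subseteq>A. card S = j \<longrightarrow> proj_dim (generated S) = ns j) \<and>
     (\<forall>S\<subseteq>A. card S = d + 2 \<longrightarrow> generated S = W)"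

text \<open>
  An outcome of the dealer's selection: the secret, a hyperplane, and the shares, where
  participant \<open>j\<close> (\<open>j < N\<close>) receives the \<open>j\<close>-th entry of the list.
\<close>

type_synonym ('a, 'n) deal =
  "('a ^ 'n) set \<times> ('a ^ 'n) set \<times> ('a ^ 'n) set list"

definition secret :: "('a, 'n::finite) deal \<Rightarrow> ('a ^ 'n) set" where
  "secret t = fst t"

definition shares :: "('a, 'n::finite) deal \<Rightarrow> ('a ^ 'n) set list" where
  "shares t = snd (snd t)"

text \<open>
  All admissible selections in \<open>PG(n + 1, q)\<close> for given public data; \<open>\<pi>'\<close> is the published subspace.
\<close>

definition deals ::
  "nat \<Rightarrow> nat \<Rightarrow> nat \<Rightarrow> (nat \<Rightarrow> int) \<Rightarrow> ('a::field ^ 'n) set \<Rightarrow> ('a, 'n::finite) deal set" where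
  "deals k N n d \<pi>' =
     {(\<pi>, H, s).
        vec.subspace \<pi> \<and> proj_dim \<pi> = d 1 \<and> \<pi> \<subseteq> \<pi>' \<and>
        vec.subspace H \<and> proj_dim H = int n \<and> \<pi> \<subseteq> H \<and> \<not> \<pi>' \<subseteq> H \<and>
        (\<exists>A. generalised_arc (k - 2) n d H A \<and> card A = N + 1 \<and> \<pi> \<in> A \<and>
             distinct s \<and> set s = A - {\<pi>})}"

definition view :: "nat set \<Rightarrow> ('a, 'n::finite) deal \<Rightarrow> nat \<Rightarrow> ('a ^ 'n) set" where
  "view I t = restrict (\<lambda>j. shares t ! j) I"

text \<open>
  The public data are fixed by the set \<open>C\<close> of possible deals. The coalition \<open>I\<close> can reconstruct the
  secret of \<open>t\<close> iff its shares leave only one possible secret.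
\<close>

definition can_reconstruct :: "('a, 'n::finite) deal set \<Rightarrow> nat set \<Rightarrow> ('a, 'n::finite) deal \<Rightarrow> bool" where
  "can_reconstruct C I t \<longleftrightarrow> (\<forall>t'\<in>C. view I t' = view I t \<longrightarrow> secret t' = secret t)"

definition secret_sharing_scheme :: "nat \<Rightarrow> nat \<Rightarrow> ('a, 'n::finite) deal set \<Rightarrow> bool" where
  "secret_sharing_scheme k N C \<longleftrightarrow>
     C \<noteq> {} \<and> (\<forall>t\<in>C. length (shares t) = N) \<and>
     (\<forall>I\<subseteq>{..<N}. card I = k \<longrightarrow> (\<forall>t\<in>C. can_reconstruct C I t)) \<and>
     (\<forall>I\<subseteq>{..<N}. card I < k \<longrightarrow> (\<forall>t\<in>C. \<not> can_reconstruct C I t))"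

text \<open>
  The deal is uniformly distributed on \<open>C\<close>. The posterior is the conditional distribution of the
  secret given the shares that the coalition \<open>I\<close> holds in the deal \<open>t\<close>; the success probability of
  the best guess is the largest posterior probability of a single candidate secret.
\<close>

definition posterior ::
  "('a, 'n::finite) deal set \<Rightarrow> nat set \<Rightarrow> ('a, 'n::finite) deal \<Rightarrow> ('a ^ 'n) set pmf" where
  "posterior C I t =
     map_pmf secret (cond_pmf (pmf_of_set C) {t'. view I t' = view I t})"

definition attack_probability ::
  "('a::{field,finite}, 'n::finite) deal set \<Rightarrow> nat set \<Rightarrow> ('a, 'n::finite) deal \<Rightarrow> real" where
  "attack_probability C I t = (MAX X. pmf (posterior C I t) X)"

end

theory Submission
  imports Defs
begin

text \<open>
  Everything rests on what a coalition \<open>I\<close> of \<open>i < k\<close> participants knows: the span \<open>U\<close> of its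
  shares and the public subspace \<open>\<pi>'\<close>. The hyperplane \<open>H\<close> of the deal meets \<open>\<pi>'\<close> exactly in the
  secret \<open>\<pi>\<close>, and \<open>U \<subseteq> H\<close>; hence the secret is a hyperplane of \<open>\<pi>'\<close> that contains \<open>U \<inter> \<pi>'\<close>, and
  \<open>U \<inter> \<pi>' = U \<inter> \<pi>\<close>. Since \<open>\<pi>\<close> is itself an arc element, the shares together with \<open>\<pi>\<close> generate a
  subspace of dimension \<open>d (i + 1)\<close>, and the dimension formula gives that \<open>U \<inter> \<pi>'\<close> has codimension
  \<open>c = d (i + 1) - d i + 1\<close> in \<open>\<pi>'\<close> (\<open>codim_coalition_knowledge\<close>). There are \<open>(q ^ c - 1) / (q - 1)\<close>
  hyperplanes of \<open>\<pi>'\<close> above a subspace of codimension \<open>c\<close> (\<open>card_hyperplanes_above\<close>).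

  All these candidates are equally likely. For any two of them some linear involution of the
  whole space fixes \<open>U\<close> pointwise, preserves \<open>\<pi>'\<close> and exchanges the two
  (\<open>linear_involution_swapping_hyperplanes\<close>). It permutes the deals that the coalition considers
  possible, so each candidate is the secret of equally many of them
  (\<open>consistent_deals_equidistributed\<close>), and the best guess succeeds with probability
  \<open>(q - 1) / (q ^ c - 1)\<close>. As \<open>d\<close> increases strictly, \<open>c \<ge> 2\<close>, so there is more than one candidate and
  the secret cannot be reconstructed. In contrast, \<open>k\<close> shares span \<open>H\<close> and thus determine the
  secret as \<open>H \<inter> \<pi>'\<close>.

  Finally, deals exist because an arc of an abstract \<open>n\<close>-dimensional space can be embedded as an arc
  of a hyperplane and then moved by a linear automorphism so that a chosen element of it becomes the
  intersection of the hyperplane with \<open>\<pi>'\<close> (\<open>deals_nonempty\<close>).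
\<close>

section \<open>Counting hyperplanes above a subspace\<close>

lemma one_less_card_field: "1 < CARD('a::{field,finite})"
proof -
  have "card {0, 1 :: 'a} \<le> CARD('a)" by (rule card_mono) simp_all
  then show ?thesis by simp
qed

lemma card_span_insert:
  fixes a :: "'a::{field,finite} ^ 'n"
  assumes "a \<notin> vec.span S"
  shows "card (vec.span (insert a S)) = CARD('a) * card (vec.span S)"
proof -
  let ?f = "\<lambda>(k, x). k *s a + x"
  have "bij_betw ?f (UNIV \<times> vec.span S) (vec.span (insert a S))"
    unfolding bij_betw_def
  proof
    show "inj_on ?f (UNIV \<times> vec.span S)"
    proof (rule inj_onI, clarsimp)
      fix k l x y
      assume x: "x \<in> vec.span S" and y: "y \<in> vec.span S" and eq: "k *s a + x = l *s a + y"
      have "(k - l) *s a = y - x"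
        using eq by (simp add: vec.scale_left_diff_distrib algebra_simps)
      then have "(k - l) *s a \<in> vec.span S"
        using x y vec.span_diff by metis
      from vec.span_scale[OF this, of "inverse (k - l)"]
      have "(inverse (k - l) * (k - l)) *s a \<in> vec.span S"
        by (simp only: vec.scale_scale)
      then have "k - l = 0"
        using assms left_inverse[of "k - l"] vec.scale_one[of a] by metis
      then show "k = l \<and> x = y" using eq by simp
    qed
    show "?f ` (UNIV \<times> vec.span S) = vec.span (insert a S)"
    proof safe
      fix k x assume "x \<in> vec.span S"
      then show "k *s a + x \<in> vec.span (insert a S)"
        by (auto simp: vec.span_breakdown_eq intro: exI[of _ k])
    next
      fix x assume "x \<in> vec.span (insert a S)"
      then obtain k where "x - k *s a \<in> vec.span S"
        by (auto simp: vec.span_breakdown_eq)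
      then show "x \<in> ?f ` (UNIV \<times> vec.span S)"
        by (intro image_eqI[of _ _ "(k, x - k *s a)"]) auto
    qed
  qed
  then show ?thesis
    by (metis bij_betw_same_card card_cartesian_product)
qed

lemma card_subspace:
  fixes S :: "('a::{field,finite} ^ 'n) set"
  assumes "vec.subspace S"
  shows "card S = CARD('a) ^ vec.dim S"
proof -
  obtain B where B: "B \<subseteq> S" "vec.independent B" "S \<subseteq> vec.span B" "card B = vec.dim S"
    using vec.basis_exists by metis
  have "finite B" by simp
  then have "vec.independent B \<Longrightarrow> card (vec.span B) = CARD('a) ^ card B"
  proof (induction B)
    case (insert b B)
    have "b \<notin> vec.span B"
      using insert.prems insert.hyps by (simp add: vec.independent_insert)
    moreover have "vec.independent B"
      using insert.prems vec.independent_mono by blast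
    ultimately show ?case
      using insert card_span_insert[of b B] by simp
  qed simp
  moreover have "vec.span B = S"
    using B assms by (intro vec.span_subspace)
  ultimately show ?thesis using B by simp
qed

definition hyperplanes_above :: "('a::field ^ 'n) set \<Rightarrow> ('a ^ 'n) set \<Rightarrow> ('a ^ 'n) set set" where
  "hyperplanes_above W P =
     {K. vec.subspace K \<and> W \<subseteq> K \<and> K \<subseteq> P \<and> Suc (vec.dim K) = vec.dim P}"

text \<open>
  Induction on the codimension, by double counting the pairs \<open>(x, K)\<close> with \<open>x \<in> K - W\<close>. The hyperplanes
  through a given \<open>x\<close> are those above \<open>vec.span (insert x W)\<close>, whose codimension is one smaller. This
  avoids the correspondence between hyperplanes and linear functionals. The subtraction on naturals
  is exact on both sides.
\<close>

lemma card_hyperplanes_above: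
  fixes W P :: "('a::{field,finite} ^ 'n) set"
  assumes "vec.subspace W" "vec.subspace P" "W \<subseteq> P" "vec.dim P = vec.dim W + Suc c"
  shows "card (hyperplanes_above W P) * (CARD('a) - 1) = CARD('a) ^ Suc c - 1"
  using assms
proof (induction c arbitrary: W)
  case 0
  have "K = W" if "K \<in> hyperplanes_above W P" for K
    using that 0 vec.subspace_dim_equal[of W K] by (auto simp: hyperplanes_above_def)
  then have "hyperplanes_above W P = {W}"
    using 0 by (auto simp: hyperplanes_above_def)
  then show ?case by simp
next
  case (Suc c)
  let ?q = "CARD('a)" and ?Q = "hyperplanes_above W P" and ?w = "vec.dim W"
  have q: "?q > 1" by (rule one_less_card_field)
  have above_x: "card {K \<in> ?Q. x \<in> K} * (?q - 1) = ?q ^ Suc c - 1" if x: "x \<in> P - W" for x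
  proof -
    have "{K \<in> ?Q. x \<in> K} = hyperplanes_above (vec.span (insert x W)) P"
    proof -
      have "vec.span (insert x W) \<subseteq> K \<longleftrightarrow> W \<subseteq> K \<and> x \<in> K" if "vec.subspace K" for K
        using that vec.span_minimal[of "insert x W" K] vec.span_superset[of "insert x W"] by auto
      then show ?thesis by (auto simp: hyperplanes_above_def)
    qed
    moreover have "vec.span (insert x W) \<subseteq> P"
      using x Suc.prems by (intro vec.span_minimal) auto
    moreover have "vec.dim (vec.span (insert x W)) = Suc ?w"
      using x Suc.prems by (simp add: vec.dim_insert vec.span_eq_iff[THEN iffD2])
    ultimately show ?thesis
      using Suc.IH[of "vec.span (insert x W)"] Suc.prems by simp
  qed
  have in_K: "card {x \<in> P - W. x \<in> K} = ?q ^ (?w + Suc c) - ?q ^ ?w" if K: "K \<in> ?Q" for K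
  proof -
    have "{x \<in> P - W. x \<in> K} = K - W" "W \<subseteq> K" "vec.dim K = ?w + Suc c" "vec.subspace K"
      using K Suc.prems by (auto simp: hyperplanes_above_def)
    then show ?thesis
      using Suc.prems by (simp add: card_Diff_subset card_subspace)
  qed
  have "(\<Sum>x\<in>P - W. card {K \<in> ?Q. x \<in> K}) = (?q ^ (?w + Suc c) - ?q ^ ?w) * card ?Q"
    by (rule sum_multicount) (use in_K in auto)
  then have "(?q ^ (?w + Suc c) - ?q ^ ?w) * card ?Q * (?q - 1)
      = (\<Sum>x\<in>P - W. card {K \<in> ?Q. x \<in> K} * (?q - 1))"
    by (simp only: sum_distrib_right[symmetric])
  also have "\<dots> = (\<Sum>x\<in>P - W. ?q ^ Suc c - 1)"
    using above_x by (rule sum.cong[OF refl])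
  also have "\<dots> = (?q ^ (?w + Suc (Suc c)) - ?q ^ ?w) * (?q ^ Suc c - 1)"
    using Suc.prems by (simp add: card_Diff_subset card_subspace)
  finally have "?q ^ ?w * (?q ^ Suc c - 1) * (card ?Q * (?q - 1))
      = ?q ^ ?w * (?q ^ Suc c - 1) * (?q ^ Suc (Suc c) - 1)"
    by (simp add: power_add diff_mult_distrib2 algebra_simps)
  moreover have "?q ^ Suc c > 1" using q by (intro one_less_power) auto
  ultimately show ?case using q by simp
qed

section \<open>A symmetry between candidate secrets\<close>

text \<open>
  Choose \<open>a \<in> K1 - K2\<close> and \<open>b \<in> K2 - K1\<close>. Because \<open>U\<close> meets \<open>P\<close> only inside \<open>K1 \<inter> K2\<close>, the vectors \<open>a\<close> and
  \<open>b\<close> stay independent modulo \<open>M = U + (K1 \<inter> K2)\<close>. So a basis of \<open>M\<close> extends by \<open>a\<close>, \<open>b\<close> and further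
  vectors to a basis of the whole space, and the transposition of the two basis vectors \<open>a\<close> and \<open>b\<close>
  is a linear involution that fixes \<open>M\<close>. It exchanges \<open>K1\<close>, which is spanned by \<open>K1 \<inter> K2\<close> and \<open>a\<close>,
  with \<open>K2\<close>, which is spanned by \<open>K1 \<inter> K2\<close> and \<open>b\<close>.
\<close>

lemma linear_involution_swapping_hyperplanes:
  fixes U P :: "('a::field ^ 'n) set"
  assumes U: "vec.subspace U" and P: "vec.subspace P"
    and K: "K1 \<in> hyperplanes_above (U \<inter> P) P" "K2 \<in> hyperplanes_above (U \<inter> P) P"
  shows "\<exists>g. Vector_Spaces.linear (*s) (*s) g \<and> g \<circ> g = id \<and> (\<forall>x\<in>U. g x = x) \<and>
    g ` P = P \<and> g ` K1 = K2"
proof (cases "K1 = K2")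
  case True
  then show ?thesis
    using vec.linear_id by (intro exI[of _ id]) auto
next
  case False
  have sub: "vec.subspace K1" "vec.subspace K2" "U \<inter> P \<subseteq> K1" "U \<inter> P \<subseteq> K2" "K1 \<subseteq> P" "K2 \<subseteq> P"
    and dim: "Suc (vec.dim K1) = vec.dim P" "Suc (vec.dim K2) = vec.dim P"
    using K by (auto simp: hyperplanes_above_def)
  have "\<not> K1 \<subseteq> K2" "\<not> K2 \<subseteq> K1"
    using False sub dim vec.subspace_dim_equal[of K1 K2] vec.subspace_dim_equal[of K2 K1] by auto
  then obtain a b where a: "a \<in> K1" "a \<notin> K2" and b: "b \<in> K2" "b \<notin> K1" by auto
  define M where "M = vec.span (U \<union> (K1 \<inter> K2))"
  have "vec.span U = U" "vec.span (K1 \<inter> K2) = K1 \<inter> K2"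
    using U sub by (auto simp: vec.subspace_inter)
  then have M: "\<exists>u\<in>U. \<exists>y\<in>K1 \<inter> K2. x = u + y" if "x \<in> M" for x
    using that unfolding M_def vec.span_Un by blast
  have a_M: "a \<notin> M"
  proof
    assume "a \<in> M"
    then obtain u y where uy: "u \<in> U" "y \<in> K1 \<inter> K2" "a = u + y" using M by blast
    then have "u = a - y" by simp
    then have "u \<in> P" using a uy sub P by (metis IntE subsetD vec.subspace_diff)
    then show False using uy a sub vec.subspace_add[of K2 u y] by auto
  qed
  have b_M: "b \<notin> vec.span (insert a M)"
  proof
    assume "b \<in> vec.span (insert a M)"
    then obtain c where "b - c *s a \<in> M"
      by (auto simp: vec.span_breakdown_eq M_def vec.span_span)
    then obtain u y where uy: "u \<in> U" "y \<in> K1 \<inter> K2" "b - c *s a = u + y" using M by blast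
    then have u: "u = b - c *s a - y" by (simp add: algebra_simps)
    then have "u \<in> P"
      using a b uy sub P by (metis IntE subsetD vec.subspace_diff vec.subspace_scale)
    then have "u \<in> K1" using uy sub by auto
    then have "u + y + c *s a \<in> K1"
      using uy a sub by (intro vec.subspace_add vec.subspace_scale) auto
    then show False using b u by simp
  qed
  obtain B where B: "B \<subseteq> M" "vec.independent B" "M \<subseteq> vec.span B"
    using vec.basis_exists by metis
  have span_B: "vec.span B = M"
    using B by (intro vec.span_subspace) (auto simp: M_def)
  have "vec.independent (insert b (insert a B))"
  proof (intro vec.independent_insertI)
    show "a \<notin> vec.span B" using a_M span_B by simp
    have "vec.span (insert a B) \<subseteq> vec.span (insert a M)"
      using B by (intro vec.span_mono) auto
    then show "b \<notin> vec.span (insert a B)" using b_M by auto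
  qed (fact B(2))
  then obtain E where E: "vec.independent E" "vec.span E = UNIV" "insert b (insert a B) \<subseteq> E"
    by (metis vec.extend_basis_superset vec.independent_extend_basis vec.span_extend_basis)
  obtain g where g: "Vector_Spaces.linear (*s) (*s) g" and gE: "\<And>x. x \<in> E \<Longrightarrow> g x = Transposition.transpose a b x"
    using vec.linear_independent_extend[OF E(1), of "Transposition.transpose a b"] by blast
  interpret g: Vector_Spaces.linear "(*s)" "(*s)" g by fact
  have ab: "g a = b" "g b = a" using gE E by auto
  have g_M: "g x = x" if "x \<in> M" for x
  proof (rule vec.linear_eq_on[OF g vec.linear_id[unfolded id_def]])
    show "x \<in> vec.span B" using that span_B by simp
    fix y assume y: "y \<in> B"
    have "b \<notin> M" using b_M by (meson subset_insertI subsetD vec.span_superset vec.span_mono)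
    then have "y \<noteq> a" "y \<noteq> b" using y B a_M by auto
    then show "g y = y" using gE y E by auto
  qed
  have gg: "g (g x) = x" for x
  proof (rule vec.linear_eq_on[OF Vector_Spaces.linear_compose[OF g g, unfolded o_def] vec.linear_id[unfolded id_def]])
    show "x \<in> vec.span E" using E by simp
    fix y assume y: "y \<in> E"
    then have "Transposition.transpose a b y \<in> E" using E by (auto simp: Transposition.transpose_def)
    then show "g (g y) = y" using gE y by simp
  qed
  have P_eq: "vec.span (insert c K) = P" 
    if "vec.subspace K" "K \<subseteq> P" "Suc (vec.dim K) = vec.dim P" "c \<in> P" "c \<notin> K" for c K
  proof -
    have "vec.dim (vec.span (insert c K)) = vec.dim P"
      using that by (simp add: vec.dim_insert vec.span_eq_iff[THEN iffD2])
    moreover have "vec.span (insert c K) \<subseteq> P"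
      using that P by (intro vec.span_minimal) auto
    ultimately show ?thesis
      using P vec.subspace_dim_equal[of "vec.span (insert c K)" P] by simp
  qed
  have abP: "a \<in> P" "b \<in> P" using a b sub by auto
  have decomp: "\<exists>r y. y \<in> K \<and> x = r *s c + y"
    if "vec.subspace K" "K \<subseteq> P" "Suc (vec.dim K) = vec.dim P" "c \<in> P" "c \<notin> K" "x \<in> P" for x c K
  proof -
    have "x \<in> vec.span (insert c K)" using P_eq that by simp
    then obtain r where "x - r *s c \<in> vec.span K" by (auto simp: vec.span_breakdown_eq)
    then have "x - r *s c \<in> K" using that by (simp add: vec.span_eq_iff[THEN iffD2])
    then show ?thesis by (intro exI[of _ r] exI[of _ "x - r *s c"]) simp
  qed
  have fix12: "g y = y" if "y \<in> K1" "y \<in> K2" for y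
    using that by (intro g_M) (auto simp: M_def vec.span_base)
  have K12: "g x \<in> K2" if x: "x \<in> K1" for x
  proof -
    obtain r y where ry: "y \<in> K2" "x = r *s a + y"
      using decomp[of K2 a x] sub dim a abP x by blast
    then have "y = x - r *s a" by simp
    then have "y \<in> K1" using x a sub by (metis vec.subspace_diff vec.subspace_scale)
    then have "g x = r *s b + y" using ry fix12 ab by (simp add: g.add g.scale)
    then show ?thesis using ry b sub by (simp add: vec.subspace_add vec.subspace_scale)
  qed
  have K21: "g x \<in> K1" if x: "x \<in> K2" for x
  proof -
    obtain r y where ry: "y \<in> K1" "x = r *s b + y"
      using decomp[of K1 b x] sub dim b abP x by blast
    then have "y = x - r *s b" by simp
    then have "y \<in> K2" using x b sub by (metis vec.subspace_diff vec.subspace_scale)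
    then have "g x = r *s a + y" using ry fix12 ab by (simp add: g.add g.scale)
    then show ?thesis using ry a sub by (simp add: vec.subspace_add vec.subspace_scale)
  qed
  have gP: "g x \<in> P" if x: "x \<in> P" for x
  proof -
    obtain r y where ry: "y \<in> K2" "x = r *s a + y"
      using decomp[of K2 a x] sub dim a abP x by blast
    then have "g x = r *s b + g y" using ab by (simp add: g.add g.scale)
    then show ?thesis
      using K21[OF ry(1)] b sub P by (metis subsetD vec.subspace_add vec.subspace_scale)
  qed
  have "g ` P = P" "g ` K1 = K2"
    using gP K12 K21 gg by (auto simp: image_iff) metis+
  moreover have "\<forall>x\<in>U. g x = x"
    using g_M by (auto simp: M_def vec.span_base)
  ultimately show ?thesis
    using g gg by (intro exI[of _ g]) (auto simp: fun_eq_iff)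
qed

section \<open>Transporting arcs and deals along linear maps\<close>

lemma generated_image:
  assumes "Vector_Spaces.linear (*s) (*s) f"
  shows "generated ((`) f ` S) = f ` generated S"
proof -
  interpret f: Vector_Spaces.linear "(*s)" "(*s)" f by fact
  show ?thesis
    unfolding generated_def f.span_image[symmetric] by (simp add: image_Union)
qed

lemma proj_dim_image:
  assumes "Vector_Spaces.linear (*s) (*s) f" "inj f"
  shows "proj_dim (f ` W) = proj_dim W"
  using assms vec.dim_image_eq[OF assms(1) inj_on_subset[OF assms(2)]] by (simp add: proj_dim_def)

text \<open>
  Injective linear maps, possibly between spaces of different dimension, preserve dimensions and
  spans. The same fact embeds an abstract arc into a larger space and moves the arc of a deal by an
  automorphism.
\<close>

lemma generalised_arc_image:
  assumes f: "Vector_Spaces.linear (*s) (*s) f" "inj f" and arc: "generalised_arc d n ns W A"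
  shows "generalised_arc d n ns (f ` W) ((`) f ` A)"
proof -
  interpret f: Vector_Spaces.linear "(*s)" "(*s)" f by fact
  have sub: "\<exists>T\<subseteq>A. S = (`) f ` T \<and> card S = card T" if "S \<subseteq> (`) f ` A" for S
  proof -
    obtain T where "T \<subseteq> A" "S = (`) f ` T" using \<open>S \<subseteq> (`) f ` A\<close> by (meson subset_imageE)
    moreover have "inj_on ((`) f) T"
      using f(2) by (auto simp: inj_on_def inj_image_eq_iff)
    ultimately show ?thesis by (auto simp: card_image)
  qed
  show ?thesis
    unfolding generalised_arc_def
  proof (intro conjI ballI allI impI)
    fix j S assume j: "j \<in> {1..d + 1}" and S: "S \<subseteq> (`) f ` A" "card S = j"
    then obtain T where "T \<subseteq> A" "S = (`) f ` T" "card T = j" using sub by metis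
    then show "proj_dim (generated S) = ns j"
      using arc j by (auto simp: generalised_arc_def generated_image proj_dim_image f)
  next
    fix S assume S: "S \<subseteq> (`) f ` A" "card S = d + 2"
    then obtain T where "T \<subseteq> A" "S = (`) f ` T" "card T = d + 2" using sub by metis
    then show "generated S = f ` W"
      using arc by (auto simp: generalised_arc_def generated_image f)
  qed (use arc in \<open>auto simp: generalised_arc_def proj_dim_image f f.subspace_image\<close>)
qed

definition map_deal :: "('a ^ 'n \<Rightarrow> 'a ^ 'n) \<Rightarrow> ('a, 'n::finite) deal \<Rightarrow> ('a, 'n) deal" where
  "map_deal g = (\<lambda>(\<pi>, H, s). (g ` \<pi>, g ` H, map ((`) g) s))"

lemma secret_map_deal [simp]: "secret (map_deal g t) = g ` secret t"
  and shares_map_deal [simp]: "shares (map_deal g t) = map ((`) g) (shares t)"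
  by (auto simp: map_deal_def secret_def shares_def split: prod.splits)

lemma map_deal_in_deals:
  assumes g: "Vector_Spaces.linear (*s) (*s) g" "inj g" and t: "t \<in> deals k N n d P"
  shows "map_deal g t \<in> deals k N n d (g ` P)"
proof -
  interpret g: Vector_Spaces.linear "(*s)" "(*s)" g by fact
  obtain \<pi> H s where t_eq: "t = (\<pi>, H, s)" by (cases t)
  then obtain A where A: "generalised_arc (k - 2) n d H A" "card A = N + 1" "\<pi> \<in> A"
      "distinct s" "set s = A - {\<pi>}"
    and sub: "vec.subspace \<pi>" "proj_dim \<pi> = d 1" "\<pi> \<subseteq> P" "vec.subspace H" "proj_dim H = int n"
      "\<pi> \<subseteq> H" "\<not> P \<subseteq> H"
    using t by (auto simp: deals_def)
  have inj: "inj ((`) g)" using g by (simp add: inj_image_eq_iff inj_on_def)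
  have "set (map ((`) g) s) = (`) g ` A - {g ` \<pi>}"
    using A(5) image_set_diff[OF inj, of A "{\<pi>}"] by simp
  moreover have "distinct (map ((`) g) s)"
    using A inj by (auto simp: distinct_map intro: inj_on_subset)
  moreover have "card ((`) g ` A) = N + 1"
    using A inj by (simp add: card_image inj_on_subset)
  moreover have "g ` \<pi> \<in> (`) g ` A" using A by simp
  ultimately have "\<exists>A. generalised_arc (k - 2) n d (g ` H) A \<and> card A = N + 1 \<and> g ` \<pi> \<in> A \<and>
      distinct (map ((`) g) s) \<and> set (map ((`) g) s) = A - {g ` \<pi>}"
    using generalised_arc_image[OF g A(1)] by blast
  then show ?thesis
    using sub by (simp add: t_eq map_deal_def deals_def g.subspace_image proj_dim_image g
        inj_image_subset_iff del: set_map)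
qed

section \<open>Uniform distributions\<close>

text \<open>
  Mutual inequalities between the fibres suffice as the hypothesis since \<open>X\<close> and \<open>Y\<close> are
  interchangeable in it; they are what an injection between fibres provides.
\<close>

lemma pmf_map_equidistributed:
  assumes F: "finite F" "F \<noteq> {}" and Q: "f ` F \<subseteq> Q" "finite Q"
    and eq: "\<And>X Y. X \<in> Q \<Longrightarrow> Y \<in> Q \<Longrightarrow> card {t \<in> F. f t = X} \<le> card {t \<in> F. f t = Y}"
  shows "pmf (map_pmf f (pmf_of_set F)) X = (if X \<in> Q then 1 / card Q else 0)"
proof -
  have "pmf (map_pmf f (pmf_of_set F)) X = card {t \<in> F. f t = X} / card F"
    using F by (simp add: pmf_map measure_pmf_of_set vimage_def Int_def)
  moreover have "card F = card Q * card {t \<in> F. f t = X}" if "X \<in> Q"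
  proof -
    have "(\<Sum>t\<in>F. card {Y \<in> Q. f t = Y}) = card {t \<in> F. f t = X} * card Q"
      using eq that F Q by (intro sum_multicount) (auto intro: order.antisym)
    moreover have "{Y \<in> Q. f t = Y} = {f t}" if "t \<in> F" for t using that Q by auto
    ultimately show ?thesis by simp
  qed
  moreover have "card F > 0" using F by (simp add: card_gt_0_iff)
  moreover have "{t \<in> F. f t = X} = {}" if "X \<notin> Q" using that Q by auto
  ultimately show ?thesis by (cases "X \<in> Q") (auto simp: divide_simps)
qed

lemma cond_pmf_of_set:
  assumes "finite A" "A \<inter> S \<noteq> {}"
  shows "cond_pmf (pmf_of_set A) S = pmf_of_set (A \<inter> S)"
proof (rule pmf_eqI)
  fix x
  have "A \<noteq> {}" using assms by auto
  moreover from this have "set_pmf (pmf_of_set A) \<inter> S \<noteq> {}" using assms by simp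
  moreover have "card A > 0" using assms by (auto simp: card_gt_0_iff)
  ultimately show "pmf (cond_pmf (pmf_of_set A) S) x = pmf (pmf_of_set (A \<inter> S)) x"
    using assms by (auto simp: pmf_cond measure_pmf_of_set pmf_of_set indicator_def)
qed

section \<open>The knowledge of a coalition\<close>

text \<open>
  \<open>P\<close> is the public subspace. The context fixes only the public data, as every deal brings its own arc.
\<close>

locale arc_sharing =
  fixes k N n :: nat and d :: "nat \<Rightarrow> int" and P :: "('a::{field,finite} ^ 'n) set"
  assumes k: "k \<ge> 2"
    and formal: "d 0 = -1" "d k = int n"
    and public: "vec.subspace P" "proj_dim P = d 1 + 1"
begin

abbreviation C :: "('a, 'n) deal set" where "C \<equiv> deals k N n d P"

definition coalition_span :: "nat set \<Rightarrow> ('a, 'n) deal \<Rightarrow> ('a ^ 'n) set" where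
  "coalition_span I t = generated ((!) (shares t) ` I)"

definition consistent_deals :: "nat set \<Rightarrow> ('a, 'n) deal \<Rightarrow> ('a, 'n) deal set" where
  "consistent_deals I t = {t' \<in> C. view I t' = view I t}"

lemma view_eq_iff: "view I t' = view I t \<longleftrightarrow> (\<forall>j\<in>I. shares t' ! j = shares t ! j)"
  by (auto simp: view_def restrict_def fun_eq_iff)

lemma coalition_span_cong: "view I t' = view I t \<Longrightarrow> coalition_span I t' = coalition_span I t"
  by (simp add: view_eq_iff coalition_span_def)

lemma subspace_coalition_span: "vec.subspace (coalition_span I t)"
  by (simp add: coalition_span_def generated_def)

text \<open>
  The formal values \<open>d 0 = -1\<close> and \<open>d k = n\<close> extend the defining property of an arc uniformly to
  \<open>0\<close> elements, which generate the zero subspace, and to \<open>k\<close> elements, which generate the whole space.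
\<close>

lemma arc_generated_dim:
  assumes arc: "generalised_arc (k - 2) n d W A" and S: "S \<subseteq> A" "finite S" "card S \<le> k"
  shows "proj_dim (generated S) = d (card S)"
proof -
  have "card S = 0 \<or> card S \<in> {1..k - 2 + 1} \<or> card S = k"
    using S k by (simp only: atLeastAtMost_iff) linarith
  then show ?thesis
  proof (elim disjE)
    assume "card S = 0"
    then show ?thesis using S formal by (simp add: generated_def proj_dim_def)
  next
    assume "card S \<in> {1..k - 2 + 1}"
    then show ?thesis using arc S by (auto simp: generalised_arc_def)
  next
    assume "card S = k"
    moreover have "k - 2 + 2 = k" using k by simp
    ultimately show ?thesis using arc S formal by (auto simp: generalised_arc_def)
  qed
qed

lemma arc_parameters_increasing:
  assumes arc: "generalised_arc (k - 2) n d W A" and "i < k"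
  shows "d i < d (i + 1)"
proof -
  consider "i = 0" | "i \<in> {1..k - 2}" | "i = k - 1" "i = k - 2 + 1" "i + 1 = k"
    using assms k by force
  then show ?thesis
    using arc formal by cases (auto simp: generalised_arc_def)
qed

lemma dealE:
  assumes "t \<in> C"
  obtains \<pi> H s where "t = (\<pi>, H, s)" "vec.subspace \<pi>" "proj_dim \<pi> = d 1" "\<pi> \<subseteq> P"
    "vec.subspace H" "\<pi> \<subseteq> H" "\<not> P \<subseteq> H"
    "generalised_arc (k - 2) n d H (insert \<pi> (set s))" "\<pi> \<notin> set s" "distinct s" "length s = N"
proof -
  obtain \<pi> H s where t_eq: "t = (\<pi>, H, s)" by (cases t)
  then obtain A where A: "generalised_arc (k - 2) n d H A" "card A = N + 1" "\<pi> \<in> A"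
      "distinct s" "set s = A - {\<pi>}"
    and sub: "vec.subspace \<pi>" "proj_dim \<pi> = d 1" "\<pi> \<subseteq> P" "vec.subspace H" "\<pi> \<subseteq> H" "\<not> P \<subseteq> H"
    using assms by (auto simp: deals_def)
  have "insert \<pi> (set s) = A" using A by auto
  moreover have "length s = N"
    using A by (metis add_diff_cancel_right' card_Diff_singleton distinct_card)
  ultimately show ?thesis using that[OF t_eq sub] A by auto
qed

text \<open>
  \<open>\<pi> \<subseteq> H \<inter> P \<subset> P\<close>, and \<open>\<pi>\<close> already has codimension one in \<open>P\<close>.
\<close>

lemma hyperplane_meets_public_in_secret:
  assumes "vec.subspace \<pi>" "proj_dim \<pi> = d 1" "\<pi> \<subseteq> P" "vec.subspace H" "\<pi> \<subseteq> H" "\<not> P \<subseteq> H"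
  shows "H \<inter> P = \<pi>"
proof -
  have HP: "vec.subspace (H \<inter> P)"
    using assms public by (simp add: vec.subspace_inter)
  have "H \<inter> P \<noteq> P" using assms by auto
  then have "vec.dim (H \<inter> P) < vec.dim P"
    using HP public vec.subspace_dim_equal[of "H \<inter> P" P] vec.dim_subset[of "H \<inter> P" P]
    by (meson inf_le2 leI)
  then have "vec.dim (H \<inter> P) \<le> vec.dim \<pi>"
    using assms public by (simp add: proj_dim_def)
  then show ?thesis
    using HP assms vec.subspace_dim_equal[of \<pi> "H \<inter> P"] by auto
qed

lemma shares_of_coalition:
  assumes "distinct s" "length s = N" "I \<subseteq> {..<N}"
  shows "(!) s ` I \<subseteq> set s" "card ((!) s ` I) = card I" "finite ((!) s ` I)"
proof -
  have "inj_on ((!) s) I"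
    using assms by (intro inj_on_nth) auto
  then show "card ((!) s ` I) = card I" by (rule card_image)
  show "finite ((!) s ` I)" using assms(3) finite_subset by blast
qed (use assms in auto)

lemma coalition_span_dim:
  assumes "t \<in> C" "I \<subseteq> {..<N}" "card I \<le> k"
  shows "proj_dim (coalition_span I t) = d (card I)"
  using assms(1)
proof (rule dealE)
  fix \<pi> H s assume t: "t = (\<pi>, H, s)" "distinct s" "length s = N"
    and arc: "generalised_arc (k - 2) n d H (insert \<pi> (set s))"
  show ?thesis
    using arc_generated_dim[OF arc, of "(!) s ` I"] shares_of_coalition[OF t(2,3) assms(2)] assms(3)
    by (auto simp: coalition_span_def shares_def t)
qed

lemma coalition_span_meets_public:
  assumes "t \<in> C" "I \<subseteq> {..<N}"
  shows "coalition_span I t \<inter> P = coalition_span I t \<inter> secret t"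
  using assms(1)
proof (rule dealE)
  fix \<pi> H s assume t: "t = (\<pi>, H, s)" "distinct s" "length s = N"
    and sub: "vec.subspace \<pi>" "proj_dim \<pi> = d 1" "\<pi> \<subseteq> P" "vec.subspace H" "\<pi> \<subseteq> H" "\<not> P \<subseteq> H"
    and arc: "generalised_arc (k - 2) n d H (insert \<pi> (set s))"
  have "\<forall>X\<in>set s. X \<subseteq> H" using arc by (simp add: generalised_arc_def)
  then have "\<Union> ((!) s ` I) \<subseteq> H"
    using shares_of_coalition(1)[OF t(2,3) assms(2)] by blast
  then have "coalition_span I t \<subseteq> H"
    using sub by (simp add: coalition_span_def shares_def t generated_def vec.span_minimal)
  then show ?thesis
    using hyperplane_meets_public_in_secret[OF sub] by (auto simp: secret_def t)
qed

lemma consistent_secret: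
  assumes t: "t \<in> C" and I: "I \<subseteq> {..<N}" and t': "t' \<in> consistent_deals I t"
  shows "secret t' \<in> hyperplanes_above (coalition_span I t \<inter> P) P"
proof -
  have C: "t' \<in> C" using t' by (simp add: consistent_deals_def)
  have eq: "coalition_span I t' = coalition_span I t"
    using t' by (intro coalition_span_cong) (simp add: consistent_deals_def)
  have "coalition_span I t \<inter> P \<subseteq> secret t'"
    using coalition_span_meets_public[OF C I] eq by auto
  moreover have "vec.subspace (secret t')" "secret t' \<subseteq> P" "proj_dim (secret t') = d 1"
    by (rule dealE[OF C], simp add: secret_def)+
  ultimately show ?thesis
    using public by (simp add: hyperplanes_above_def proj_dim_def)
qed

text \<open>
  The dimension formula for \<open>U\<close> and \<open>\<pi>\<close>: the sum \<open>U + \<pi>\<close> is generated by \<open>card I + 1\<close> distinct elements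
  of the arc, and the intersection is all of \<open>U \<inter> P\<close>.
\<close>

lemma codim_coalition_knowledge:
  assumes t: "t \<in> C" and I: "I \<subseteq> {..<N}" "card I < k"
  shows "int (vec.dim P) =
    int (vec.dim (coalition_span I t \<inter> P)) + (d (card I + 1) - d (card I) + 1)"
  using t
proof (rule dealE)
  let ?U = "coalition_span I t"
  fix \<pi> H s assume t_eq: "t = (\<pi>, H, s)" and s: "distinct s" "length s = N" "\<pi> \<notin> set s"
    and \<pi>: "vec.subspace \<pi>" "proj_dim \<pi> = d 1"
    and arc: "generalised_arc (k - 2) n d H (insert \<pi> (set s))"
  let ?S = "(!) s ` I"
  note S = shares_of_coalition[OF s(1,2) I(1)]
  have "card (insert \<pi> ?S) = card I + 1" using S s by (subst card_insert_disjoint) auto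
  then have "proj_dim (generated (insert \<pi> ?S)) = d (card I + 1)"
    using arc_generated_dim[OF arc, of "insert \<pi> ?S"] S I by auto
  moreover have "generated (insert \<pi> ?S) = {x + y |x y. x \<in> ?U \<and> y \<in> \<pi>}"
    using \<pi> by (simp add: generated_def coalition_span_def shares_def t_eq Un_commute[of \<pi>]
        vec.span_Un vec.span_eq_iff[THEN iffD2])
  moreover have "?U \<inter> P = ?U \<inter> \<pi>"
    using coalition_span_meets_public[OF t I(1)] by (simp add: t_eq secret_def)
  ultimately show ?thesis
    using vec.dim_sums_Int[OF subspace_coalition_span \<pi>(1), of I t]
      coalition_span_dim[OF t I(1)] I \<pi> public
    by (simp add: proj_dim_def)
qed

lemma finite_deals: "finite C"
proof (rule finite_subset)
  show "C \<subseteq> UNIV \<times> UNIV \<times> {s. set s \<subseteq> UNIV \<and> length s = N}"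
    by (auto elim: dealE)
  show "finite (UNIV \<times> UNIV \<times> {s :: ('a ^ 'n) set list. set s \<subseteq> UNIV \<and> length s = N} :: ('a, 'n) deal set)"
    by (intro finite_cartesian_product finite_lists_length_eq) simp_all
qed

text \<open>
  The involution that exchanges \<open>X1\<close> and \<open>X2\<close> and fixes the span of the coalition's shares acts
  injectively on the deals with the coalition's view and turns the secret \<open>X1\<close> into \<open>X2\<close>.
\<close>

lemma consistent_deals_equidistributed:
  assumes t: "t \<in> C" and I: "I \<subseteq> {..<N}"
    and X: "X1 \<in> hyperplanes_above (coalition_span I t \<inter> P) P"
      "X2 \<in> hyperplanes_above (coalition_span I t \<inter> P) P"
  shows "card {t' \<in> consistent_deals I t. secret t' = X1} \<le> card {t' \<in> consistent_deals I t. secret t' = X2}"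
proof -
  obtain g where g: "Vector_Spaces.linear (*s) (*s) g" "g \<circ> g = id" "\<And>x. x \<in> coalition_span I t \<Longrightarrow> g x = x"
    "g ` P = P" "g ` X1 = X2"
    using linear_involution_swapping_hyperplanes[OF subspace_coalition_span public(1) X] by blast
  have gg: "g ` g ` Y = Y" for Y using g(2) by (simp add: image_comp)
  have "inj g" using g(2) by (metis inj_on_id inj_on_imageI2)
  have "inj_on (map_deal g) C"
  proof (rule inj_on_inverseI)
    show "map_deal g (map_deal g t') = t'" for t' :: "('a, 'n) deal"
      by (simp add: map_deal_def gg map_idI split: prod.splits)
  qed
  moreover have "map_deal g t' \<in> consistent_deals I t" if t': "t' \<in> consistent_deals I t" for t'
  proof -
    have C: "t' \<in> C" and eq: "\<And>j. j \<in> I \<Longrightarrow> shares t' ! j = shares t ! j"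
      using t' by (auto simp: consistent_deals_def view_eq_iff)
    have "length (shares t') = N" by (rule dealE[OF C]) (simp add: shares_def)
    moreover have "g ` (shares t ! j) = shares t ! j" if "j \<in> I" for j
    proof -
      have "shares t ! j \<subseteq> coalition_span I t"
        unfolding coalition_span_def generated_def
        using that by (rule order.trans[OF UN_upper vec.span_superset])
      then have "\<forall>x\<in>shares t ! j. g x = x" using g(3) by blast
      then show ?thesis by simp
    qed
    ultimately show ?thesis
      using map_deal_in_deals[OF g(1) \<open>inj g\<close> C] g(4) I eq
      by (auto simp: consistent_deals_def view_eq_iff)
  qed
  ultimately show ?thesis
    using g(5) finite_deals
    by (intro card_inj_on_le[of "map_deal g"])
      (auto simp: consistent_deals_def elim: inj_on_subset)
qed

section \<open>Reconstruction, secrecy and attack probabilities\<close>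

lemma secret_subset_coalition_span:
  assumes "t \<in> C" "I \<subseteq> {..<N}" "card I = k"
  shows "secret t \<subseteq> coalition_span I t"
  using assms(1)
proof (rule dealE)
  fix \<pi> H s assume t: "t = (\<pi>, H, s)" "distinct s" "length s = N" "\<pi> \<subseteq> H"
    and arc: "generalised_arc (k - 2) n d H (insert \<pi> (set s))"
  have "card ((!) s ` I) = k - 2 + 2" "(!) s ` I \<subseteq> insert \<pi> (set s)"
    using shares_of_coalition[OF t(2,3) assms(2)] assms(3) k by auto
  then have "generated ((!) s ` I) = H"
    using arc unfolding generalised_arc_def by blast
  then show ?thesis using t by (simp add: coalition_span_def secret_def shares_def)
qed

lemma can_reconstruct_threshold:
  assumes t: "t \<in> C" and I: "I \<subseteq> {..<N}" "card I = k"
  shows "can_reconstruct C I t"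
proof -
  have "secret t' = coalition_span I t' \<inter> P" if "t' \<in> C" for t'
    using secret_subset_coalition_span[OF that I] coalition_span_meets_public[OF that I(1)] by auto
  then show ?thesis
    unfolding can_reconstruct_def using t coalition_span_cong by metis
qed

text \<open>
  The codimension is \<open>Suc c\<close> with \<open>c \<ge> 1\<close> because \<open>d\<close> is strictly increasing. So there are at least two
  candidates, which is what secrecy below the threshold needs.
\<close>

lemma card_candidate_secrets:
  assumes t: "t \<in> C" and I: "I \<subseteq> {..<N}" "card I < k"
  obtains c where "c \<ge> 1" "d (card I + 1) - d (card I) + 1 = int (Suc c)"
    "card (hyperplanes_above (coalition_span I t \<inter> P) P) * (CARD('a) - 1) = CARD('a) ^ Suc c - 1"
proof -
  have "d (card I) < d (card I + 1)"
    using dealE[OF t] arc_parameters_increasing I by metis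
  then obtain c where c: "c \<ge> 1" "d (card I + 1) - d (card I) + 1 = int (Suc c)"
    by (intro that[of "nat (d (card I + 1) - d (card I))"]) auto
  moreover have "vec.dim P = vec.dim (coalition_span I t \<inter> P) + Suc c"
    using codim_coalition_knowledge[OF t I] c by linarith
  ultimately show ?thesis
    using public subspace_coalition_span
    by (intro that[OF c] card_hyperplanes_above) (auto simp: vec.subspace_inter)
qed

lemma cannot_reconstruct_below_threshold:
  assumes t: "t \<in> C" and I: "I \<subseteq> {..<N}" "card I < k"
  shows "\<not> can_reconstruct C I t"
proof -
  let ?Q = "hyperplanes_above (coalition_span I t \<inter> P) P"
  obtain c where c: "c \<ge> 1" "card ?Q * (CARD('a) - 1) = CARD('a) ^ Suc c - 1"
    using card_candidate_secrets[OF t I] by blast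
  have "CARD('a) ^ 1 < CARD('a) ^ Suc c"
    using one_less_card_field[where ?'a = 'a] c by (intro power_strict_increasing) auto
  then have "CARD('a) - 1 < CARD('a) ^ Suc c - 1"
    using one_less_card_field[where ?'a = 'a] unfolding power_one_right by (intro diff_less_mono) simp_all
  then have "card ?Q \<noteq> 1" using c(2) by force
  have t_cons: "t \<in> consistent_deals I t" using t by (simp add: consistent_deals_def)
  then have "secret t \<in> ?Q" using consistent_secret[OF t I(1)] by blast
  moreover have "?Q \<noteq> {secret t}" using \<open>card ?Q \<noteq> 1\<close> by auto
  ultimately obtain X where X: "X \<in> ?Q" "X \<noteq> secret t" by blast
  have "finite {t' \<in> consistent_deals I t. secret t' = secret t}"
    using finite_deals by (simp add: consistent_deals_def)
  moreover have "t \<in> {t' \<in> consistent_deals I t. secret t' = secret t}" using t_cons by simp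
  ultimately have "card {t' \<in> consistent_deals I t. secret t' = secret t} > 0"
    using card_gt_0_iff by blast
  then have "card {t' \<in> consistent_deals I t. secret t' = X} > 0"
    using consistent_deals_equidistributed[OF t I(1) \<open>secret t \<in> ?Q\<close> X(1)] by linarith
  then have "{t' \<in> consistent_deals I t. secret t' = X} \<noteq> {}" by force
  then show ?thesis using X by (auto simp: can_reconstruct_def consistent_deals_def)
qed

lemma attack_probability_below_threshold:
  assumes t: "t \<in> C" and I: "I \<subseteq> {..<N}" "card I < k"
  shows "attack_probability C I t =
    (real CARD('a) - 1) / (real CARD('a) powi (d (card I + 1) - d (card I) + 1) - 1)"
proof -
  let ?Q = "hyperplanes_above (coalition_span I t \<inter> P) P"
  let ?F = "consistent_deals I t"
  obtain c where c: "c \<ge> 1" "d (card I + 1) - d (card I) + 1 = int (Suc c)"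
    "card ?Q * (CARD('a) - 1) = CARD('a) ^ Suc c - 1"
    using card_candidate_secrets[OF t I] .
  have t_cons: "t \<in> ?F" using t by (simp add: consistent_deals_def)
  have Q: "secret ` ?F \<subseteq> ?Q" using consistent_secret[OF t I(1)] by blast
  have F: "?F = C \<inter> {t'. view I t' = view I t}" by (auto simp: consistent_deals_def)
  have "posterior C I t = map_pmf secret (pmf_of_set ?F)"
    unfolding posterior_def F using t finite_deals by (subst cond_pmf_of_set) auto
  then have posterior: "pmf (posterior C I t) X = (if X \<in> ?Q then 1 / card ?Q else 0)" for X
    using pmf_map_equidistributed[of ?F secret ?Q X] Q t_cons finite_deals
      consistent_deals_equidistributed[OF t I(1)] F by fastforce
  have "attack_probability C I t = 1 / card ?Q"
    unfolding attack_probability_def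
  proof (rule Max_eqI)
    show "1 / card ?Q \<in> range (pmf (posterior C I t))"
      using Q t_cons posterior by (intro image_eqI[of _ _ "secret t"]) auto
  qed (auto simp: posterior)
  moreover have "real (card ?Q) * (real CARD('a) - 1) = real CARD('a) ^ Suc c - 1"
    using arg_cong[OF c(3), of real] one_less_card_field[where ?'a = 'a] by (simp add: of_nat_diff)
  moreover have "real CARD('a) powi (d (card I + 1) - d (card I) + 1) = real CARD('a) ^ Suc c"
    unfolding c(2) by (rule power_int_of_nat)
  moreover have "real CARD('a) - 1 > 0" using one_less_card_field[where ?'a = 'a] by simp
  ultimately show ?thesis by (metis divide_divide_eq_left' divide_self less_irrefl)
qed

section \<open>Existence of deals\<close>

text \<open>
  Let \<open>e\<close> embed the coordinate space of the given arc as a hyperplane, let \<open>\<pi>0\<close> be an arc element and \<open>v\<close>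
  a vector outside the hyperplane. The span of \<open>v\<close> and \<open>e ` \<pi>0\<close> has the dimension of \<open>P\<close>, so some linear
  automorphism \<open>g\<close> maps it onto \<open>P\<close>. Then \<open>g ` e ` \<pi>0\<close> lies in \<open>P\<close>, while \<open>g v \<in> P\<close> lies outside the
  image of the hyperplane.
\<close>

lemma deals_nonempty:
  assumes dims: "CARD('m) = n + 1" "CARD('n) = n + 2"
    and arc: "generalised_arc (k - 2) n d UNIV (A :: ('a ^ 'm) set set)" "card A = N + 1"
  shows "C \<noteq> {}"
proof -
  have "\<exists>f :: 'm \<Rightarrow> 'n. inj f"
    using card_le_inj[of "UNIV :: 'm set" "UNIV :: 'n set"] dims by auto
  then obtain f :: "'m \<Rightarrow> 'n" where f: "inj f" by auto
  define e :: "'a ^ 'm \<Rightarrow> 'a ^ 'n" where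
    "e x = (\<chi> i. if i \<in> range f then x $ inv f i else 0)" for x
  have e: "Vector_Spaces.linear (*s) (*s) e"
    by (rule Vector_Spaces.linear.intro) (unfold_locales, auto simp: e_def vec_eq_iff vector_space_over_itself.scale_right_distrib)
  have "inj e"
  proof (rule injI)
    fix x y assume "e x = e y"
    then have "e x $ f j = e y $ f j" for j by simp
    then show "x = y" using f by (simp add: e_def vec_eq_iff)
  qed
  interpret e: Vector_Spaces.linear "(*s)" "(*s)" e by fact
  obtain \<pi>0 where \<pi>0: "\<pi>0 \<in> A" using arc by fastforce
  then have \<pi>0_dim: "vec.subspace \<pi>0" "proj_dim \<pi>0 = d 1"
    using arc by (auto simp: generalised_arc_def)
  have "proj_dim (range e) = int n"
    using proj_dim_image[OF e \<open>inj e\<close>, of UNIV] dims by (simp add: proj_dim_def card_cart_basis)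
  then have "range e \<noteq> UNIV"
    using dims by (auto simp: proj_dim_def card_cart_basis)
  then obtain v where v: "v \<notin> range e" by blast
  obtain B0 where B0: "B0 \<subseteq> e ` \<pi>0" "vec.independent B0" "e ` \<pi>0 \<subseteq> vec.span B0" "card B0 = vec.dim (e ` \<pi>0)"
    using vec.basis_exists by metis
  have span_B0: "vec.span B0 = e ` \<pi>0"
    using B0 \<pi>0_dim e.subspace_image by (intro vec.span_subspace) auto
  have v_B0: "v \<notin> vec.span B0" using v span_B0 by auto
  obtain B1 where B1: "B1 \<subseteq> P" "vec.independent B1" "P \<subseteq> vec.span B1" "card B1 = vec.dim P"
    using vec.basis_exists by metis
  have span_B1: "vec.span B1 = P" using B1 public by (intro vec.span_subspace) auto
  have ind: "vec.independent (insert v B0)" using B0 v_B0 by (intro vec.independent_insertI)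
  have "v \<notin> B0" using v_B0 vec.span_base by blast
  then have "card (insert v B0) = card B1"
    using B0 B1 public \<pi>0_dim proj_dim_image[OF e \<open>inj e\<close>, of \<pi>0] by (simp add: proj_dim_def)
  then obtain h where h: "bij_betw h (insert v B0) B1"
    using finite_same_card_bij[of "insert v B0" B1] by auto
  then obtain g where g: "Vector_Spaces.linear (*s) (*s) g" "inj g" "\<And>x. x \<in> insert v B0 \<Longrightarrow> g x = h x"
    using vec.linear_independent_extend_inj[OF ind, of h] B1(2) unfolding bij_betw_def by blast
  interpret g: Vector_Spaces.linear "(*s)" "(*s)" g by fact
  have "g ` insert v B0 = B1" using g(3) h by (simp add: bij_betw_def cong: image_cong_simp)
  then have gP: "g ` vec.span (insert v B0) = P"
    using g.span_image[of "insert v B0"] span_B1 by simp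
  let ?f = "g \<circ> e"
  have lin: "Vector_Spaces.linear (*s) (*s) ?f" and inj: "inj ?f"
    using Vector_Spaces.linear_compose[OF e g(1)] \<open>inj e\<close> g(2) by (auto intro: inj_compose)
  interpret f: Vector_Spaces.linear "(*s)" "(*s)" ?f by (fact lin)
  let ?A = "(`) ?f ` A"
  have arc': "generalised_arc (k - 2) n d (range ?f) ?A"
    using generalised_arc_image[OF lin inj arc(1)] .
  have "inj_on ((`) ?f) A" using inj by (auto simp: inj_on_def inj_image_eq_iff)
  then have card: "card ?A = N + 1" using arc(2) by (simp only: card_image)
  obtain s where s: "set s = ?A - {?f ` \<pi>0}" "distinct s"
    using finite_distinct_list[of "?A - {?f ` \<pi>0}"] by auto
  have "?f ` \<pi>0 \<subseteq> P"
    using gP span_B0 vec.span_mono[of B0 "insert v B0"] by (auto simp: image_comp[symmetric])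
  moreover have "\<not> P \<subseteq> range ?f"
  proof
    assume "P \<subseteq> range ?f"
    moreover have "g v \<in> P" using gP vec.span_base[of v "insert v B0"] by blast
    ultimately obtain x where "g v = g (e x)" by auto
    then show False using g(2) v by (auto dest: injD)
  qed
  moreover have "?f ` \<pi>0 \<in> ?A" using \<pi>0 by blast
  moreover have "proj_dim (range ?f) = int n" using arc' by (simp add: generalised_arc_def)
  moreover have "vec.subspace (range ?f)" using arc' by (simp add: generalised_arc_def)
  moreover have "vec.subspace (?f ` \<pi>0)" "proj_dim (?f ` \<pi>0) = d 1"
    using \<pi>0_dim f.subspace_image proj_dim_image[OF lin inj] by (simp_all only:)
  moreover have "?f ` \<pi>0 \<subseteq> range ?f" by (rule image_mono) simp
  ultimately have "(?f ` \<pi>0, range ?f, s) \<in> C"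
    unfolding deals_def mem_Collect_eq prod.case using arc' card s by (intro conjI exI[of _ ?A])
  then show ?thesis by blast
qed

end

section \<open>The sharing scheme\<close>

theorem theorem9:
  fixes q k N n :: nat
    and d :: "nat \<Rightarrow> int"
    and \<pi>' :: "('a::{field,finite} ^ 'n) set"
  assumes q: "q = CARD('a)"
    and k: "k \<ge> 2" and N: "N \<ge> k" and n: "n \<ge> 1"
    and dims: "CARD('m) = n + 1" "CARD('n) = n + 2"
    and formal: "d 0 = -1" "d k = int n"
    and arc_exists: "\<exists>A :: ('a ^ 'm) set set. generalised_arc (k - 2) n d UNIV A \<and> card A = N + 1"
    and public: "vec.subspace \<pi>'" "proj_dim \<pi>' = d 1 + 1"
  shows "secret_sharing_scheme k N (deals k N n d \<pi>') \<and>
    (\<forall>i<k. \<forall>I\<subseteq>{..<N}. card I = i \<longrightarrow>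
       (\<forall>t\<in>deals k N n d \<pi>'.
          attack_probability (deals k N n d \<pi>') I t =
            (real q - 1) / (real q powi (d (i + 1) - d i + 1) - 1)))"
proof -
  interpret arc_sharing k N n d \<pi>'
    using k formal public by unfold_locales
  obtain A :: "('a ^ 'm) set set" where "generalised_arc (k - 2) n d UNIV A" "card A = N + 1"
    using arc_exists by blast
  then have "C \<noteq> {}" by (rule deals_nonempty[OF dims])
  moreover have "length (shares t) = N" if "t \<in> C" for t
    by (rule dealE[OF that]) (simp add: shares_def)
  ultimately show ?thesis
    using can_reconstruct_threshold cannot_reconstruct_below_threshold
      attack_probability_below_threshold q
    by (simp add: secret_sharing_scheme_def)
qed

end
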